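(* Let $d\ge1$, $p\ge 2$ and let $E\subset \mathbb{R}^d$ be a compact set. (1) Assume that there is a Borel probability measure $\sigma$ with $\operatorname{supp}(\sigma)\subset E$ such that $$\int_{\mathbb{R}^d}|\widehat{\sigma}(x)|^{p}\,dx<\infty .$$ Assume also that for each $\epsilon>0$ there is a finite partition of $\operatorname{supp}(\sigma)$ into Borel sets with equal $\sigma$-measure and diameter less than $\epsilon$. Then there are constants $R_0,c,C>0$ such that for each $R\ge R_0$ there is a finite set of points $\mathcal{P}_R\subset E$ with cardinality $cR^{2d/p}\le|\mathcal{P}_R|\le CR^{2d/p}$ and $$\frac{1}{|B(0,R)|}\int_{B(0,R)}\Big|\sum_{\xi\in\mathcal{P}_R} e(\xi\cdot x)\Big|^p\,dx\le C|\mathcal{P}_R|^{p/2}.$$ (2) Conversely, suppose that there are constants $c,C>0$ and a sequence $R_k\to\infty$ such that for each $R=R_k$ there is a finite set $\mathcal{P}_R\subset E$ with $cR^{2d/p}\le|\mathcal{P}_R|\le CR^{2d/p}$ and $$\frac{1}{|B(0,R)|}\int_{B(0,R)}\Big|\sum_{\xi\in\mathcal{P}_R} e(\xi\cdot x)\Big|^p\,dx\le C|\mathcal{P}_R|^{p/2}.$$ Then there is a Borel probability measure $\sigma$ with $\operatorname{supp}(\sigma)\subset E$ and $\int_{\mathbb{R}^d}|\widehat{\sigma}(x)|^{p}\,dx<\infty$.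
   Context: Here $e(t)=e^{2\pi i t}$, $B(0,R)=\{x\in\mathbb{R}^d:|x|\le R\}$, $|B(0,R)|$ is its Lebesgue measure, and $\widehat{\sigma}(x)=\int e(\xi\cdot x)\,d\sigma(\xi)$. *)

theory Defs
  imports "HOL-Probability.Probability"
begin

definition expo :: "real \<Rightarrow> complex"
  where "expo t = exp (2 * of_real pi * \<i> * of_real t)"

definition borel_prob :: "(real ^ 'n) measure \<Rightarrow> bool"
  where "borel_prob \<sigma> \<longleftrightarrow> prob_space \<sigma> \<and> sets \<sigma> = sets borel"

definition msupp :: "'a::topological_space measure \<Rightarrow> 'a set"
  where "msupp \<sigma> = {x. \<forall>U. open U \<longrightarrow> x \<in> U \<longrightarrow> emeasure \<sigma> U > 0}"

definition fourier :: "(real ^ 'n) measure \<Rightarrow> real ^ 'n \<Rightarrow> complex"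
  where "fourier \<sigma> x = (LINT \<xi>|\<sigma>. expo (\<xi> \<bullet> x))"

(* Stated with the nonnegative integral: the Bochner integral of a non-integrable function is 0. *)
definition fourier_Lp :: "real \<Rightarrow> (real ^ 'n) measure \<Rightarrow> bool"
  where "fourier_Lp p \<sigma> \<longleftrightarrow> (\<integral>\<^sup>+ x. ennreal (norm (fourier \<sigma> x) powr p) \<partial>lborel) < \<infinity>"

(* The blocks are bounded whenever msupp \<sigma> is contained in a compact set, so their library
   diameter (a conditionally complete supremum) is the true one. *)
definition has_equal_partitions :: "(real ^ 'n) measure \<Rightarrow> bool"
  where "has_equal_partitions \<sigma> \<longleftrightarrow>
    (\<forall>\<epsilon>>0. \<exists>\<A>. finite \<A> \<and> partition_on (msupp \<sigma>) \<A> \<and>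
        (\<forall>A\<in>\<A>. A \<in> sets borel \<and> diameter A < \<epsilon>) \<and>
        (\<forall>A\<in>\<A>. \<forall>B\<in>\<A>. measure \<sigma> A = measure \<sigma> B))"

definition ball_average :: "real \<Rightarrow> real \<Rightarrow> (real ^ 'n) set \<Rightarrow> real"
  where "ball_average p R P =
    1 / measure lborel (cball (0 :: real ^ 'n) R) *
    (LINT x:cball 0 R|lborel. norm (\<Sum>\<xi>\<in>P. expo (\<xi> \<bullet> x)) powr p)"

(* CARD('n) is the dimension d; the same C bounds the cardinality and the average. *)
definition good_frequencies ::
    "real \<Rightarrow> (real ^ 'n) set \<Rightarrow> real \<Rightarrow> real \<Rightarrow> real \<Rightarrow> (real ^ 'n) set \<Rightarrow> bool"
  where "good_frequencies p E c C R P \<longleftrightarrow>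
    finite P \<and> P \<subseteq> E \<and>
    c * R powr (2 * real CARD('n) / p) \<le> real (card P) \<and>
    real (card P) \<le> C * R powr (2 * real CARD('n) / p) \<and>
    ball_average p R P \<le> C * real (card P) powr (p / 2)"

end

theory Submission
  imports Defs
begin

text \<open>
  Write \<open>S\<close> for the exponential sum of a set of \<open>N\<close> frequencies and \<open>d\<close> for the dimension. Both
  directions rest on the balance of exponents that \<open>N\<close> comparable to \<open>R powr (2 * d / p)\<close> means
  \<open>N powr (p / 2)\<close> comparable to \<open>R powr d\<close>, hence to the volume of the ball of radius \<open>R\<close>.

  From a measure to frequencies: draw \<open>N\<close> independent points with law \<open>\<sigma>\<close>. At each \<open>x\<close> the sum \<open>S x\<close>
  has mean \<open>N * fourier \<sigma> x\<close> and is a sum of bounded independent terms, so by Hoeffding's lemma its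
  deviation from the mean has \<open>p\<close>-th moment of order \<open>N powr (p / 2)\<close>
  (\<open>random_exponential_sum_moment\<close>). Integrated over the ball, the deviation contributes
  \<open>N powr (p / 2)\<close> times the volume, and the mean contributes \<open>N powr p\<close> times the \<open>p\<close>-th power of the
  \<open>L\<^sup>p\<close> norm of the transform, which by the balance of exponents is of the same order. By Tonelli
  the expected ball average is therefore at most a constant times \<open>N powr (p / 2)\<close>, and some sample
  does no worse than twice that. The sample has to consist of \<open>N\<close> different points. That happens
  almost surely because a measure whose transform lies in \<open>L\<^sup>p\<close> has no atoms
  (\<open>emeasure_singleton_eq_0_if_fourier_Lp\<close>).

  From frequencies to a measure: let \<open>\<sigma>\<^sub>k\<close> be the uniform probability measure on the \<open>k\<close>-th set. The
  hypothesis on the ball average bounds the integral of \<open>norm (fourier \<sigma>\<^sub>k x) powr p\<close> over the ball of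
  radius \<open>r k\<close> uniformly in \<open>k\<close>. As \<open>E\<close> is compact, a subsequence converges weakly to a probability
  measure on \<open>E\<close> (\<open>pmf_weak_limit\<close>). The transforms then converge pointwise, and Fatou's lemma
  bounds the \<open>L\<^sup>p\<close> norm of the limit. Weak compactness in dimension \<open>d\<close> is reduced to Helly's
  theorem on the real line by covering \<open>E\<close> with a continuous image of a compact set of reals
  (\<open>compact_subset_of_curve\<close>).
\<close>

section \<open>Characters, balls and Fourier transforms\<close>

lemma norm_expo [simp]: "norm (expo t) = 1"
  by (simp add: expo_def mult.assoc mult.left_commute[of _ \<i>] flip: of_real_mult cis_conv_exp)

lemma continuous_on_expo [continuous_intros]:
  "continuous_on A f \<Longrightarrow> continuous_on A (\<lambda>x. expo (f x))"
  unfolding expo_def by (intro continuous_intros)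

lemma measurable_expo [measurable]: "expo \<in> borel_measurable borel"
  by (intro borel_measurable_continuous_onI continuous_intros)

lemma expo_add: "expo (s + t) = expo s * expo t"
  by (simp add: expo_def exp_add algebra_simps)

lemma expo_minus: "expo (- t) = cnj (expo t)"
  by (simp add: expo_def exp_cnj)

lemma measure_cball_pos: "R > 0 \<Longrightarrow> measure lborel (cball (0 :: real ^ 'n) R) > 0"
  by (rule content_cball_pos)

lemma measure_cball_scale:
  assumes "R > 0"
  shows "measure lborel (cball (0 :: real ^ 'n) R) =
         measure lborel (cball (0 :: real ^ 'n) 1) * R powr real CARD('n)"
  using assms by (simp add: content_cball powr_realpow)

lemma emeasure_cball_eq_measure:
  "emeasure lborel (cball (0 :: real ^ 'n) R) = ennreal (measure lborel (cball (0 :: real ^ 'n) R))"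
  using emeasure_bounded_finite[OF bounded_cball, of "0 :: real ^ 'n" R]
  by (intro emeasure_eq_ennreal_measure) simp

text \<open>
  The averages are defined by Bochner integrals, while Tonelli and Fatou are applied to nonnegative
  integrals. This identity passes between the two.
\<close>
lemma nn_integral_cball_exponential_sum:
  fixes P :: "(real ^ 'n) set"
  assumes "finite P" "R > 0" "p \<ge> 0"
  shows "(\<integral>\<^sup>+x. indicator (cball 0 R) x * ennreal (norm (\<Sum>\<xi>\<in>P. expo (\<xi> \<bullet> x)) powr p) \<partial>lborel) =
         ennreal (measure lborel (cball (0 :: real ^ 'n) R) * ball_average p R P)"
proof -
  define F where "F = (\<lambda>x. norm (\<Sum>\<xi>\<in>P. expo (\<xi> \<bullet> x)) powr p)"
  have "norm (\<Sum>\<xi>\<in>P. expo (\<xi> \<bullet> x)) \<le> real (card P)" for x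
    using sum_norm_le[of P "\<lambda>\<xi>. expo (\<xi> \<bullet> x)" "\<lambda>_. 1"] by simp
  hence F_le: "F x \<le> real (card P) powr p" for x
    unfolding F_def using assms(3) by (intro powr_mono2) auto
  have int: "set_integrable lborel (cball (0 :: real ^ 'n) R) F"
    unfolding set_integrable_def
  proof (rule integrableI_bounded_set_indicator)
    show "F \<in> borel_measurable lborel" unfolding F_def by measurable
    show "emeasure lborel (cball (0 :: real ^ 'n) R) < \<infinity>"
      using emeasure_bounded_finite[OF bounded_cball] by simp
    show "AE x in lborel. x \<in> cball 0 R \<longrightarrow> norm (F x) \<le> real (card P) powr p"
      using F_le by (auto simp: F_def)
  qed simp
  have "ennreal (LINT x:cball (0 :: real ^ 'n) R|lborel. F x) =
        (\<integral>\<^sup>+x. ennreal (indicator (cball 0 R) x * F x) \<partial>lborel)"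
    using int unfolding set_lebesgue_integral_def set_integrable_def
    by (subst nn_integral_eq_integral) (auto simp: F_def)
  also have "\<dots> = (\<integral>\<^sup>+x. indicator (cball 0 R) x * ennreal (F x) \<partial>lborel)"
    by (intro nn_integral_cong) (auto simp: indicator_def)
  finally show ?thesis
    using measure_cball_pos[OF assms(2), where 'n = 'n]
    by (simp add: ball_average_def F_def)
qed

lemma measurable_fourier [measurable]:
  assumes "borel_prob \<sigma>"
  shows "fourier \<sigma> \<in> borel_measurable borel"
proof -
  interpret prob_space \<sigma> using assms by (simp add: borel_prob_def)
  have [measurable_cong]: "sets \<sigma> = sets borel" using assms by (simp add: borel_prob_def)
  have "(\<lambda>x. LINT \<xi>|\<sigma>. expo (\<xi> \<bullet> x)) \<in> borel_measurable borel" by measurable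
  thus ?thesis by (simp add: fourier_def[abs_def])
qed

lemma fourier_integrable:
  assumes "borel_prob \<sigma>"
  shows "integrable \<sigma> (\<lambda>\<xi>. expo (\<xi> \<bullet> x))"
proof -
  interpret prob_space \<sigma> using assms by (simp add: borel_prob_def)
  have [measurable_cong]: "sets \<sigma> = sets borel" using assms by (simp add: borel_prob_def)
  show ?thesis by (rule integrable_const_bound[of _ 1]) auto
qed

lemma norm_fourier_le_1:
  assumes "borel_prob \<sigma>"
  shows "norm (fourier \<sigma> x) \<le> 1"
proof -
  interpret prob_space \<sigma> using assms by (simp add: borel_prob_def)
  have "norm (fourier \<sigma> x) \<le> (LINT \<xi>|\<sigma>. norm (expo (\<xi> \<bullet> x)))"
    unfolding fourier_def by (rule integral_norm_bound)
  also have "\<dots> = 1" by (simp add: prob_space)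
  finally show ?thesis .
qed

section \<open>A curve through a compact set\<close>

text \<open>
  The Cantor space, with real-valued digits so that digit series need no coercion and compactness
  is Tychonov's theorem for the product of the compact sets \<open>{0, 1}\<close>.
\<close>
definition binary_digits :: "(nat \<Rightarrow> real) set" where
  "binary_digits = {a. \<forall>k. a k \<in> {0, 1}}"

lemma compact_binary_digits: "compact binary_digits"
proof -
  have "compactin (product_topology (\<lambda>_::nat. euclidean :: real topology) UNIV) (PiE UNIV (\<lambda>_. {0, 1}))"
    by (subst compactin_PiE) (auto simp: compactin_euclidean_iff)
  moreover have "PiE UNIV (\<lambda>_::nat. {0, 1::real}) = binary_digits"
    by (auto simp: binary_digits_def PiE_def Pi_def)
  ultimately show ?thesis
    by (simp add: euclidean_product_topology compactin_euclidean_iff)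
qed

lemma summable_digits:
  assumes "a \<in> binary_digits" "summable c" "\<And>k. c k \<ge> (0::real)"
  shows "summable (\<lambda>k. a k * c k)"
proof (rule summable_comparison_test'[OF assms(2), of 0])
  fix k show "norm (a k * c k) \<le> c k"
    using assms(1) assms(3)[of k] by (cases "a k = 0") (auto simp: binary_digits_def)
qed

text \<open>
  The reindexing \<open>j\<close> makes it possible to read the digits of several coordinates off one digit
  sequence.
\<close>
lemma continuous_on_digit_series:
  fixes c :: "nat \<Rightarrow> real"
  assumes "summable c" "\<And>k. c k \<ge> 0"
  shows "continuous_on binary_digits (\<lambda>a. \<Sum>k. a (j k) * c k)"
proof (rule uniform_limit_theorem)
  show "uniform_limit binary_digits (\<lambda>n a. \<Sum>k<n. a (j k) * c k) (\<lambda>a. \<Sum>k. a (j k) * c k) sequentially"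
  proof (rule Weierstrass_m_test[OF _ assms(1)])
    fix n a assume "a \<in> binary_digits"
    thus "norm (a (j n) * c n) \<le> c n"
      using assms(2)[of n] by (cases "a (j n) = 0") (auto simp: binary_digits_def)
  qed
  show "\<forall>\<^sub>F n in sequentially. continuous_on binary_digits (\<lambda>a. \<Sum>k<n. a (j k) * c k)"
    by (intro always_eventually allI continuous_intros)
       (auto intro: continuous_on_subset[OF continuous_on_product_coordinates])
qed simp

text \<open>
  Two sequences that differ first at place \<open>j\<close> are already separated there by \<open>(1/3) ^ j\<close>, and all
  later places together can only compensate half of that. In base 2 they could compensate all of it,
  which is why base 3 is used to embed the Cantor space into the real line.
\<close>
lemma inj_on_ternary_series: "inj_on (\<lambda>a. \<Sum>k. a k * (1/3) ^ k) binary_digits"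
proof (rule inj_onI, rule ccontr)
  fix a b :: "nat \<Rightarrow> real"
  assume ab: "a \<in> binary_digits" "b \<in> binary_digits"
    and eq: "(\<Sum>k. a k * (1/3) ^ k) = (\<Sum>k. b k * (1/3) ^ k)" and "a \<noteq> b"
  then obtain k where "a k \<noteq> b k" by auto
  define j where "j = (LEAST k. a k \<noteq> b k)"
  have j: "a j \<noteq> b j" unfolding j_def by (rule LeastI[of _ k]) fact
  have less: "a i = b i" if "i < j" for i
    using not_less_Least[of i "\<lambda>k. a k \<noteq> b k"] that unfolding j_def by blast
  define d where "d = (\<lambda>k. (a k - b k) * (1/3::real) ^ k)"
  have s: "summable d"
    using summable_diff[OF summable_digits[OF ab(1), of "\<lambda>k. (1/3)^k"] summable_digits[OF ab(2), of "\<lambda>k. (1/3)^k"]]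
    unfolding d_def by (simp add: algebra_simps)
  have "(\<Sum>k. d k) = 0"
    using suminf_diff[OF summable_digits[OF ab(1), of "\<lambda>k. (1/3)^k"] summable_digits[OF ab(2), of "\<lambda>k. (1/3)^k"]] eq
    unfolding d_def by (simp add: algebra_simps)
  moreover have "(\<Sum>k. d k) = (\<Sum>k. d (k + Suc j)) + (\<Sum>k<Suc j. d k)"
    by (rule suminf_split_initial_segment[OF s])
  moreover have "(\<Sum>k<Suc j. d k) = d j"
    using less by (simp add: d_def)
  ultimately have dj: "d j = - (\<Sum>k. d (k + Suc j))" by simp
  have tail_le: "norm (d (k + Suc j)) \<le> (1/3) ^ Suc j * (1/3) ^ k" for k
  proof -
    have "\<bar>a (k + Suc j) - b (k + Suc j)\<bar> \<le> 1"
      using ab unfolding binary_digits_def by (auto dest!: spec[of _ "k + Suc j"])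
    hence "\<bar>a (k + Suc j) - b (k + Suc j)\<bar> * (1/3) ^ (k + Suc j) \<le> 1 * (1/3) ^ (k + Suc j)"
      by (intro mult_right_mono) auto
    thus ?thesis unfolding d_def by (simp add: abs_mult power_add mult.commute)
  qed
  have "norm (\<Sum>k. d (k + Suc j)) \<le> (\<Sum>k. (1/3) ^ Suc j * (1/3::real) ^ k)"
    by (rule norm_suminf_le[OF tail_le summable_mult[OF summable_geometric]]) simp
  also have "\<dots> = (1/3) ^ Suc j * (3/2)"
    by (subst suminf_mult) (auto simp: suminf_geometric)
  also have "\<dots> = (1/3)^j / 2" by simp
  finally have "\<bar>d j\<bar> \<le> (1/3) ^ j / 2" using dj by simp
  moreover have "\<bar>a j - b j\<bar> = 1"
    using ab j unfolding binary_digits_def by (auto dest!: spec[of _ j])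
  hence "\<bar>d j\<bar> = (1/3)^j" by (simp add: d_def abs_mult)
  ultimately show False by simp
qed

text \<open>
  The digits come from the floors of \<open>2 ^ k * y\<close>, whose weighted differences telescope.
\<close>
lemma binary_expansion:
  fixes y :: real
  assumes "0 \<le> y" "y < 1"
  obtains a where "a \<in> binary_digits" "(\<Sum>k. a k * (1/2) ^ Suc k) = y"
proof -
  define a where "a = (\<lambda>k. of_int (\<lfloor>2 ^ Suc k * y\<rfloor> - 2 * \<lfloor>2 ^ k * y\<rfloor>) :: real)"
  have a: "a \<in> binary_digits"
  proof -
    have "\<lfloor>2 ^ Suc k * y\<rfloor> - 2 * \<lfloor>2 ^ k * y\<rfloor> \<in> {0, 1}" for k
      unfolding power_Suc mult.assoc by (auto; linarith)
    hence "a k \<in> {0, 1}" for k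
      unfolding a_def by (metis insert_iff of_int_0 of_int_1 singletonD)
    thus ?thesis by (simp add: binary_digits_def)
  qed
  have part: "(\<Sum>k<m. a k * (1/2) ^ Suc k) = of_int \<lfloor>2 ^ m * y\<rfloor> / 2 ^ m" for m
  proof (induction m)
    case 0
    have "\<lfloor>y\<rfloor> = 0" using assms by linarith
    then show ?case by simp
  next
    case (Suc m)
    then show ?case by (simp add: a_def field_simps)
  qed
  have "(\<lambda>m. \<Sum>k<m. a k * (1/2) ^ Suc k) \<longlonglongrightarrow> y"
  proof (rule tendsto_sandwich)
    show "\<forall>\<^sub>F m in sequentially. y - (1/2) ^ m \<le> (\<Sum>k<m. a k * (1/2) ^ Suc k)"
    proof (intro always_eventually allI)
      fix m
      have "2 ^ m * y - 1 \<le> of_int \<lfloor>2 ^ m * y\<rfloor>" by linarith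
      hence "(2 ^ m * y - 1) / 2 ^ m \<le> of_int \<lfloor>2 ^ m * y\<rfloor> / 2 ^ m"
        by (intro divide_right_mono) auto
      thus "y - (1/2) ^ m \<le> (\<Sum>k<m. a k * (1/2) ^ Suc k)"
        unfolding part by (simp add: diff_divide_distrib power_divide)
    qed
    show "\<forall>\<^sub>F m in sequentially. (\<Sum>k<m. a k * (1/2) ^ Suc k) \<le> y"
    proof (intro always_eventually allI)
      fix m
      have "of_int \<lfloor>2 ^ m * y\<rfloor> \<le> 2 ^ m * y" by linarith
      thus "(\<Sum>k<m. a k * (1/2) ^ Suc k) \<le> y"
        unfolding part by (simp add: field_simps)
    qed
    have "(\<lambda>m. y - (1/2) ^ m) \<longlonglongrightarrow> y - 0"
      by (intro tendsto_intros LIMSEQ_power_zero) auto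
    thus "(\<lambda>m. y - (1/2) ^ m) \<longlonglongrightarrow> y" by simp
  qed auto
  hence "(\<lambda>k. a k * (1/2) ^ Suc k) sums y" by (simp add: sums_def)
  hence "(\<Sum>k. a k * (1/2) ^ Suc k) = y" by (rule sums_unique[symmetric])
  with a show ?thesis by (rule that)
qed

text \<open>
  The Cantor space maps continuously onto a cube that contains \<open>E\<close>, by binary expansions of the
  coordinates, and embeds into the real line by ternary series. Since it is compact, the embedding
  has a continuous inverse on its image \<open>K\<close>, which yields a continuous map from \<open>K\<close> onto the cube.
  Tietze's theorem extends it to all reals. Measures on \<open>E\<close> can thus be lifted to the line and pushed
  down again without losing continuity of test functions.
\<close>
lemma compact_subset_of_curve:
  fixes E :: "(real ^ 'n) set"
  assumes "compact E"
  obtains g :: "real \<Rightarrow> real ^ 'n" and K where "compact K" "continuous_on UNIV g" "E \<subseteq> g ` K"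
proof -
  obtain B where B: "\<And>x. x \<in> E \<Longrightarrow> norm x \<le> B" 
    using compact_imp_bounded[OF assms] by (auto simp: bounded_iff)
  define M where "M = \<bar>B\<bar> + 1"
  have M: "M > 0" by (simp add: M_def)
  obtain \<iota> :: "'n \<Rightarrow> nat" where \<iota>: "inj \<iota>"
    using finite_imp_inj_to_nat_seg[of "UNIV :: 'n set"] by auto
  \<comment> \<open>the digits at the places \<open>prod_encode (\<iota> i, k)\<close> are those of coordinate \<open>i\<close>, rescaled from
      the unit interval to the interval from \<open>- M\<close> to \<open>M\<close>\<close>
  define \<psi> :: "(nat \<Rightarrow> real) \<Rightarrow> real ^ 'n" where
    "\<psi> = (\<lambda>a. \<chi> i. 2 * M * (\<Sum>k. a (prod_encode (\<iota> i, k)) * (1/2) ^ Suc k) - M)"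
  define \<phi> :: "(nat \<Rightarrow> real) \<Rightarrow> real" where "\<phi> = (\<lambda>a. \<Sum>k. a k * (1/3) ^ k)"
  have cont_\<psi>: "continuous_on binary_digits \<psi>"
    unfolding \<psi>_def
    by (intro continuous_intros continuous_on_vec_lambda continuous_on_digit_series)
       (auto intro!: summable_mult)
  have cont_\<phi>: "continuous_on binary_digits \<phi>"
    unfolding \<phi>_def by (rule continuous_on_digit_series) auto
  have E: "E \<subseteq> \<psi> ` binary_digits"
  proof
    fix x assume x: "x \<in> E"
    have "\<exists>a. a \<in> binary_digits \<and> (\<Sum>k. a k * (1/2) ^ Suc k) = (x $ i + M) / (2 * M)" for i
    proof -
      have "\<bar>x $ i\<bar> < M"
        using component_le_norm_cart[of x i] B[OF x] by (simp add: M_def)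
      hence "0 \<le> (x $ i + M) / (2 * M)" "(x $ i + M) / (2 * M) < 1"
        using M by (auto simp: divide_less_eq)
      thus ?thesis by (rule binary_expansion) blast
    qed
    then obtain b where b: "\<And>i. b i \<in> binary_digits"
        "\<And>i. (\<Sum>k. b i k * (1/2) ^ Suc k) = (x $ i + M) / (2 * M)" by metis
    define a where "a = (\<lambda>m. b (inv \<iota> (fst (prod_decode m))) (snd (prod_decode m)))"
    have "a \<in> binary_digits" using b(1) by (simp add: a_def binary_digits_def)
    moreover have "\<psi> a = x"
      using b(2) M \<iota> by (simp add: \<psi>_def a_def vec_eq_iff del: power_Suc)
    ultimately show "x \<in> \<psi> ` binary_digits" by blast
  qed
  have compact_K: "compact (\<phi> ` binary_digits)"
    by (rule compact_continuous_image[OF cont_\<phi> compact_binary_digits])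
  have inv: "the_inv_into binary_digits \<phi> (\<phi> a) = a" if "a \<in> binary_digits" for a
    using that inj_on_ternary_series unfolding \<phi>_def[symmetric] by (simp add: the_inv_into_f_f)
  have "continuous_on (\<phi> ` binary_digits) (the_inv_into binary_digits \<phi>)"
    by (rule continuous_on_inv[OF cont_\<phi> compact_binary_digits]) (simp add: inv)
  hence "continuous_on (\<phi> ` binary_digits) (\<psi> \<circ> the_inv_into binary_digits \<phi>)"
    by (rule continuous_on_compose) (auto simp: image_image inv cont_\<psi>)
  then obtain g where g: "continuous_on UNIV g"
      "\<And>t. t \<in> \<phi> ` binary_digits \<Longrightarrow> g t = (\<psi> \<circ> the_inv_into binary_digits \<phi>) t"
    by (rule Tietze_unbounded[where U = UNIV]) (auto intro: compact_imp_closed compact_K)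
  have "E \<subseteq> g ` \<phi> ` binary_digits"
  proof
    fix x assume "x \<in> E"
    then obtain a where a: "a \<in> binary_digits" "x = \<psi> a" using E by blast
    hence "x = g (\<phi> a)" using g(2)[of "\<phi> a"] inv[of a] by simp
    with a show "x \<in> g ` \<phi> ` binary_digits" by blast
  qed
  with compact_K g(1) show ?thesis by (rule that)
qed

section \<open>Weak limits of discrete measures on a compact set\<close>

text \<open>
  The discrete measures are moved to the compact subset \<open>K\<close> of the line along a section \<open>u\<close> of the curve
  \<open>g\<close>, which is an arbitrary function and still measurable for a discrete measure.
  The lifted measures are tight, Helly's theorem gives a weakly convergent subsequence, and the limit
  is pushed forward along \<open>g\<close>. For a continuous \<open>f\<close> the composition of \<open>f\<close> with \<open>g\<close> is continuous, so
  the integrals converge.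
\<close>
lemma pmf_weak_limit:
  fixes E :: "(real ^ 'n) set" and q :: "nat \<Rightarrow> (real ^ 'n) pmf"
  assumes "compact E" and qE: "\<And>k. set_pmf (q k) \<subseteq> E"
  obtains s :: "nat \<Rightarrow> nat" and \<sigma> where "strict_mono s" "borel_prob \<sigma>" "msupp \<sigma> \<subseteq> E"
    "\<And>f :: real ^ 'n \<Rightarrow> complex. continuous_on UNIV f \<Longrightarrow> bounded (range f) \<Longrightarrow>
        (\<lambda>k. measure_pmf.expectation (q (s k)) f) \<longlonglongrightarrow> (LINT \<xi>|\<sigma>. f \<xi>)"
proof -
  obtain g :: "real \<Rightarrow> real ^ 'n" and K where K: "compact K" and g: "continuous_on UNIV g" and EK: "E \<subseteq> g ` K"
    using compact_subset_of_curve[OF assms(1)] .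
  have g_meas[measurable]: "g \<in> borel_measurable borel"
    using g by (rule borel_measurable_continuous_onI)
  define u where "u = inv_into K g"
  have u: "g (u x) = x" "u x \<in> K" if "x \<in> E" for x
    using that EK unfolding u_def by (auto intro: f_inv_into_f inv_into_into)
  define \<mu> where "\<mu> = (\<lambda>k. distr (measure_pmf (q k)) borel u)"
  have rd: "real_distribution (\<mu> k)" for k
    unfolding \<mu>_def real_distribution_def real_distribution_axioms_def
    by (auto intro!: measure_pmf.prob_space_distr)
  obtain B where B: "\<And>t. t \<in> K \<Longrightarrow> \<bar>t\<bar> \<le> B"
    using compact_imp_bounded[OF K] by (auto simp: bounded_iff)
  have AE_K: "AE x in measure_pmf (q k). x \<in> E" for k
    using qE by (auto simp: AE_measure_pmf_iff)
  have "tight \<mu>"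
    unfolding tight_def
  proof (intro conjI allI impI rd)
    fix \<epsilon> :: real assume "\<epsilon> > 0"
    have "measure (\<mu> n) {-\<bar>B\<bar>-1<..\<bar>B\<bar>} = 1" for n
    proof -
      have "AE x in measure_pmf (q n). u x \<in> {-\<bar>B\<bar>-1<..\<bar>B\<bar>}"
        using AE_K[of n]
      proof eventually_elim
        case (elim x)
        then show ?case using B[OF u(2)[OF elim]] by auto
      qed
      hence "measure_pmf.prob (q n) (u -` {-\<bar>B\<bar>-1<..\<bar>B\<bar>}) = 1"
        by (subst measure_pmf.prob_eq_1) auto
      thus ?thesis unfolding \<mu>_def by (subst measure_distr) auto
    qed
    thus "\<exists>a b. a < b \<and> (\<forall>n. measure (\<mu> n) {a<..b} > 1 - \<epsilon>)"
      using \<open>\<epsilon> > 0\<close> by (intro exI[of _ "-\<bar>B\<bar>-1"] exI[of _ "\<bar>B\<bar>"]) auto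
  qed
  from tight_imp_convergent_subsubsequence[OF this strict_mono_id]
  obtain s M where s: "strict_mono s" and M: "real_distribution M"
    and conv: "weak_conv_m (\<mu> \<circ> s) M" by (auto simp: o_def)
  interpret M: real_distribution M by (rule M)
  define \<sigma> where "\<sigma> = distr M borel g"
  have lim: "(\<lambda>k. measure_pmf.expectation (q (s k)) f) \<longlonglongrightarrow> (LINT \<xi>|\<sigma>. f \<xi>)"
    if f: "continuous_on UNIV f" "bounded (range f)" for f :: "real ^ 'n \<Rightarrow> complex"
  proof -
    obtain C where C: "\<And>x. norm (f x) \<le> C" using f(2) by (auto simp: bounded_iff)
    have f_meas[measurable]: "f \<in> borel_measurable borel"
      using f(1) by (rule borel_measurable_continuous_onI)
    have cont: "continuous_on UNIV (f \<circ> g)"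
      by (rule continuous_on_compose[OF g]) (rule continuous_on_subset[OF f(1)], simp)
    have "(\<lambda>k. integral\<^sup>L ((\<mu> \<circ> s) k) (f \<circ> g)) \<longlonglongrightarrow> integral\<^sup>L M (f \<circ> g)"
    proof (rule weak_conv_imp_integral_bdd_continuous_conv)
      show "real_distribution ((\<mu> \<circ> s) k)" for k using rd by simp
      show "weak_conv_m (\<mu> \<circ> s) M" by (rule conv)
      show "isCont (f \<circ> g) x" for x using cont by (simp add: continuous_on_eq_continuous_at del: o_apply)
      show "norm ((f \<circ> g) x) \<le> C" for x using C by simp
    qed (rule M)
    moreover have "integral\<^sup>L ((\<mu> \<circ> s) k) (f \<circ> g) = measure_pmf.expectation (q (s k)) f" for k
    proof -
      have "integral\<^sup>L ((\<mu> \<circ> s) k) (f \<circ> g) = measure_pmf.expectation (q (s k)) (\<lambda>x. (f \<circ> g) (u x))"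
        unfolding \<mu>_def comp_def by (subst integral_distr) auto
      also have "\<dots> = measure_pmf.expectation (q (s k)) f"
        by (rule integral_cong_AE) (use AE_K[of "s k"] in \<open>auto simp: u elim!: eventually_mono\<close>)
      finally show ?thesis .
    qed
    moreover have "integral\<^sup>L M (f \<circ> g) = (LINT \<xi>|\<sigma>. f \<xi>)"
      unfolding \<sigma>_def by (subst integral_distr) (auto simp: o_def)
    ultimately show ?thesis by simp
  qed
  have prob: "borel_prob \<sigma>"
    unfolding borel_prob_def \<sigma>_def by (auto intro!: M.prob_space_distr)
  interpret \<sigma>: prob_space \<sigma> using prob by (simp add: borel_prob_def)
  have sets_\<sigma>[measurable_cong]: "sets \<sigma> = sets borel" by (simp add: \<sigma>_def)
  have "msupp \<sigma> \<subseteq> E"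
  proof (rule subsetI, rule ccontr)
    fix x assume x: "x \<in> msupp \<sigma>" "x \<notin> E"
    \<comment> \<open>the truncated distance to \<open>E\<close> vanishes on all supports, so its integral against the limit is 0\<close>
    define d where "d = (\<lambda>y. min 1 (infdist y E))"
    have d_cont: "continuous_on UNIV d"
      unfolding d_def by (intro continuous_intros)
    have d01: "0 \<le> d y" "d y \<le> 1" for y by (auto simp: d_def infdist_nonneg)
    have d_meas[measurable]: "d \<in> borel_measurable borel"
      using d_cont by (rule borel_measurable_continuous_onI)
    have "(\<lambda>k. measure_pmf.expectation (q (s k)) (\<lambda>y. complex_of_real (d y))) \<longlonglongrightarrow> (LINT \<xi>|\<sigma>. complex_of_real (d \<xi>))"
      by (rule lim) (use d_cont d01 in \<open>auto intro!: continuous_intros boundedI[of _ 1]\<close>)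
    moreover have "measure_pmf.expectation (q (s k)) (\<lambda>y. complex_of_real (d y)) = 0" for k
    proof -
      have "measure_pmf.expectation (q (s k)) (\<lambda>y. complex_of_real (d y)) = measure_pmf.expectation (q (s k)) (\<lambda>y. 0)"
        by (rule integral_cong_AE) (use AE_K[of "s k"] in \<open>auto simp: d_def elim!: eventually_mono\<close>)
      thus ?thesis by simp
    qed
    ultimately have "(LINT \<xi>|\<sigma>. d \<xi>) = 0"
      by (simp add: LIMSEQ_const_iff)
    hence "AE \<xi> in \<sigma>. d \<xi> = 0"
      by (subst (asm) integral_nonneg_eq_0_iff_AE)
         (auto simp: d01 intro!: \<sigma>.integrable_const_bound[where B = 1])
    hence "AE \<xi> in \<sigma>. \<xi> \<notin> {y. d y > 0}" by eventually_elim auto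
    hence "emeasure \<sigma> {y. d y > 0} = 0"
      by (subst (asm) AE_iff_measurable[OF _ refl]) (auto simp: \<sigma>_def)
    moreover have "open {y. d y > 0}"
      using d_cont by (intro open_Collect_less) auto
    moreover have "d x > 0"
    proof (cases "E = {}")
      case True
      then show ?thesis using qE[of 0] set_pmf_not_empty[of "q 0"] by auto
    next
      case False
      then show ?thesis
        using x(2) in_closed_iff_infdist_zero[OF compact_imp_closed[OF assms(1)] False, of x] infdist_nonneg[of x E]
        by (auto simp: d_def less_le)
    qed
    ultimately show False using x(1) unfolding msupp_def by force
  qed
  with s prob lim show ?thesis by (intro that)
qed

section \<open>From exponential sums to a measure\<close>

text \<open>
  The transform of the uniform measure on \<open>P k\<close> is the normalised exponential sum. The lower bound on
  the cardinality turns the bound on the ball average into a bound on the \<open>p\<close>-th moment of this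
  transform over the ball that does not depend on \<open>k\<close>. The balls exhaust the space, so Fatou's lemma
  applies to the transforms cut off outside the balls.
\<close>
lemma measure_from_good_frequencies:
  fixes E :: "(real ^ 'n) set" and r :: "nat \<Rightarrow> real"
  assumes "p > 0" "compact E" "c > 0" "C > 0" and r: "\<And>k. r k > 0" "filterlim r at_top sequentially"
    and good: "\<And>k. good_frequencies p E c C (r k) (P k)"
  obtains \<sigma> :: "(real ^ 'n) measure" where "borel_prob \<sigma>" "msupp \<sigma> \<subseteq> E" "fourier_Lp p \<sigma>"
proof -
  define d where "d = real CARD('n)"
  have fin: "finite (P k)" and PE: "P k \<subseteq> E"
    and card_ge: "c * r k powr (2 * d / p) \<le> real (card (P k))"
    and avg: "ball_average p (r k) (P k) \<le> C * real (card (P k)) powr (p / 2)" for k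
    using good[of k] by (auto simp: good_frequencies_def d_def)
  have card_pos: "real (card (P k)) > 0" for k
  proof -
    have "0 < c * r k powr (2 * d / p)" using assms(3) r(1)[of k] by simp
    thus ?thesis using card_ge[of k] by linarith
  qed
  have ne: "P k \<noteq> {}" for k using card_pos[of k] by auto
  define q where "q = (\<lambda>k. pmf_of_set (P k))"
  have "set_pmf (q k) \<subseteq> E" for k
    unfolding q_def using PE fin ne by (simp add: set_pmf_of_set)
  with assms(2) obtain s \<sigma> where s: "strict_mono s" and \<sigma>: "borel_prob \<sigma>" "msupp \<sigma> \<subseteq> E"
    and lim: "\<And>f :: real ^ 'n \<Rightarrow> complex. continuous_on UNIV f \<Longrightarrow> bounded (range f) \<Longrightarrow>
        (\<lambda>k. measure_pmf.expectation (q (s k)) f) \<longlonglongrightarrow> (LINT \<xi>|\<sigma>. f \<xi>)"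
    using pmf_weak_limit[of E q] by metis
  define S where "S = (\<lambda>k x. \<Sum>\<xi>\<in>P k. expo (\<xi> \<bullet> x))"
  have [measurable]: "S k \<in> borel_measurable borel" for k unfolding S_def by measurable
  have [measurable]: "cball (0 :: real ^ 'n) R \<in> sets borel" for R by simp
  define h :: "nat \<Rightarrow> real ^ 'n \<Rightarrow> ennreal" where
    "h = (\<lambda>k x. indicator (cball 0 (r k)) x * ennreal (norm (S k x / of_nat (card (P k))) powr p))"
  have lim_S: "(\<lambda>k. S (s k) x / of_nat (card (P (s k)))) \<longlonglongrightarrow> fourier \<sigma> x" for x
  proof -
    have "(\<lambda>k. measure_pmf.expectation (q (s k)) (\<lambda>\<xi>. expo (\<xi> \<bullet> x))) \<longlonglongrightarrow> fourier \<sigma> x"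
      unfolding fourier_def by (rule lim) (auto intro!: continuous_intros boundedI[of _ 1])
    moreover have "measure_pmf.expectation (q k) (\<lambda>\<xi>. expo (\<xi> \<bullet> x)) = S k x / of_nat (card (P k))" for k
      unfolding q_def S_def using fin ne
      by (subst integral_measure_pmf[of "P k"])
         (auto simp: set_pmf_of_set sum_divide_distrib scaleR_conv_of_real divide_simps intro!: sum.cong)
    ultimately show ?thesis by simp
  qed
  have lim_h: "(\<lambda>k. h (s k) x) \<longlonglongrightarrow> ennreal (norm (fourier \<sigma> x) powr p)" for x
  proof -
    have "filterlim (\<lambda>k. r (s k)) at_top sequentially"
      using filterlim_compose[OF r(2) filterlim_subseq[OF s]] .
    hence "\<forall>\<^sub>F k in sequentially. norm x \<le> r (s k)"
      by (simp add: filterlim_at_top)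
    hence "\<forall>\<^sub>F k in sequentially. ennreal (norm (S (s k) x / of_nat (card (P (s k)))) powr p) = h (s k) x"
      by eventually_elim (simp add: h_def)
    moreover have "(\<lambda>k. ennreal (norm (S (s k) x / of_nat (card (P (s k)))) powr p)) \<longlonglongrightarrow>
        ennreal (norm (fourier \<sigma> x) powr p)"
      using assms(1) by (intro tendsto_ennrealI tendsto_powr' tendsto_norm lim_S tendsto_const) auto
    ultimately show ?thesis by (rule Lim_transform_eventually[rotated])
  qed
  define B where "B = measure lborel (cball (0 :: real ^ 'n) 1)"
  have B: "B > 0" unfolding B_def by (rule measure_cball_pos) simp
  have int_h: "(\<integral>\<^sup>+x. h k x \<partial>lborel) \<le> ennreal (C * B * c powr (- p / 2))" for k
  proof -
    define N where "N = real (card (P k))"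
    have N: "N > 0" using card_pos by (simp add: N_def)
    have h_eq: "h k x = ennreal (N powr (- p)) * (indicator (cball 0 (r k)) x * ennreal (norm (S k x) powr p))" for x
    proof -
      have "norm (S k x / of_nat (card (P k))) powr p = N powr (- p) * norm (S k x) powr p"
        using N by (simp add: norm_divide powr_divide powr_minus_divide N_def)
      thus ?thesis by (simp add: h_def ennreal_mult' mult_ac)
    qed
    have "(\<integral>\<^sup>+x. h k x \<partial>lborel) =
        ennreal (N powr (- p)) * (\<integral>\<^sup>+x. indicator (cball 0 (r k)) x * ennreal (norm (S k x) powr p) \<partial>lborel)"
      unfolding h_eq by (rule nn_integral_cmult) measurable
    also have "\<dots> = ennreal (N powr (- p) * (measure lborel (cball (0 :: real ^ 'n) (r k)) * ball_average p (r k) (P k)))"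
      unfolding S_def using assms(1) fin r(1)
      by (subst nn_integral_cball_exponential_sum) (auto simp: ennreal_mult')
    also have "\<dots> \<le> ennreal (C * B * c powr (- p / 2))"
    proof (rule ennreal_leI)
      have "(c * r k powr (2 * d / p)) powr (p / 2) \<le> N powr (p / 2)"
        using card_ge[of k] assms(1,3) r(1)[of k] by (intro powr_mono2) (auto simp: N_def)
      hence "c powr (p / 2) * r k powr d \<le> N powr (p / 2)"
        using assms(1,3) r(1)[of k] by (simp add: powr_mult powr_powr)
      hence "c powr (- p / 2) * (c powr (p / 2) * r k powr d) \<le> c powr (- p / 2) * N powr (p / 2)"
        by (rule mult_left_mono) simp
      hence r_le: "r k powr d \<le> c powr (- p / 2) * N powr (p / 2)"
        using assms(3) by (simp add: mult.assoc[symmetric] powr_add[symmetric])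
      have "N powr (- p) * (measure lborel (cball (0 :: real ^ 'n) (r k)) * ball_average p (r k) (P k))
            \<le> N powr (- p) * ((B * r k powr d) * (C * N powr (p / 2)))"
        unfolding measure_cball_scale[OF r(1)[of k]] B_def[symmetric] d_def[symmetric]
        using avg[of k] B by (intro mult_left_mono) (auto simp: N_def)
      also have "\<dots> \<le> N powr (- p) * ((B * (c powr (- p / 2) * N powr (p / 2))) * (C * N powr (p / 2)))"
        using r_le B assms(4) by (intro mult_left_mono mult_right_mono) auto
      also have "\<dots> = C * B * c powr (- p / 2) * (N powr (- p) * N powr (p / 2) * N powr (p / 2))"
        by (simp add: mult_ac)
      also have "N powr (- p) * N powr (p / 2) * N powr (p / 2) = 1"
        using N by (simp flip: powr_add)
      finally show "N powr (- p) * (measure lborel (cball (0 :: real ^ 'n) (r k)) * ball_average p (r k) (P k))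
            \<le> C * B * c powr (- p / 2)" by simp
    qed
    finally show ?thesis .
  qed
  have "(\<integral>\<^sup>+x. ennreal (norm (fourier \<sigma> x) powr p) \<partial>lborel) =
        (\<integral>\<^sup>+x. liminf (\<lambda>k. h (s k) x) \<partial>lborel)"
    using lim_imp_Liminf[OF _ lim_h] by simp
  also have "\<dots> \<le> liminf (\<lambda>k. \<integral>\<^sup>+x. h (s k) x \<partial>lborel)"
    by (rule nn_integral_liminf) (simp add: h_def)
  also have "\<dots> \<le> liminf (\<lambda>k. ennreal (C * B * c powr (- p / 2)))"
    by (intro Liminf_mono always_eventually allI int_h)
  also have "\<dots> < \<infinity>" by (simp add: Liminf_const)
  finally have "fourier_Lp p \<sigma>" unfolding fourier_Lp_def .
  with \<sigma> show ?thesis by (rule that)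
qed

section \<open>Moments of random exponential sums\<close>

text \<open>Apply \<open>s \<le> exp s\<close> to \<open>s = t / p\<close> and raise it to the power \<open>p\<close>.\<close>
lemma powr_le_exp:
  fixes t p :: real
  assumes "t \<ge> 0" "p > 0"
  shows "t powr p \<le> p powr p * exp t"
proof -
  have "t / p \<le> exp (t / p)"
    using exp_ge_add_one_self[of "t / p"] by linarith
  hence "(t / p) powr p \<le> exp (t / p) powr p"
    using assms by (intro powr_mono2) auto
  also have "\<dots> = exp t"
    using assms by (simp add: powr_def)
  finally show ?thesis
    using assms by (simp add: powr_divide divide_le_eq mult.commute)
qed

text \<open>
  By independence the exponential moment factors, and Hoeffding's lemma bounds each of the \<open>N\<close> factors
  by \<open>exp (l\<^sup>2 * B\<^sup>2 / 2)\<close> with \<open>l = 1 / sqrt N\<close>. The normalisation is the one for which the product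
  does not depend on \<open>N\<close>.
\<close>
lemma (in prob_space) nn_integral_exp_iid_sum_le:
  assumes [measurable]: "f \<in> borel_measurable M" and bound: "\<And>x. \<bar>f x\<bar> \<le> B"
    and mean: "expectation f = 0" and "N > 0"
  shows "(\<integral>\<^sup>+\<omega>. ennreal (exp ((\<Sum>j<N. f (\<omega> j)) / sqrt (real N))) \<partial>PiM {..<N} (\<lambda>_. M)) \<le> ennreal (exp (B\<^sup>2 / 2))"
proof -
  interpret product_sigma_finite "\<lambda>_::nat. M" by unfold_locales
  interpret interval_bounded_random_variable M f "-B" B
    by unfold_locales (use bound in \<open>auto simp: abs_le_iff minus_le_iff\<close>)
  define l where "l = 1 / sqrt (real N)"
  have l: "l > 0" "l\<^sup>2 * real N = 1" using assms(4) by (auto simp: l_def power_divide)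
  have prod_eq: "ennreal (exp ((\<Sum>j<N. f (\<omega> j)) / sqrt (real N))) = (\<Prod>j<N. ennreal (exp (l * f (\<omega> j))))" for \<omega>
    by (subst prod_ennreal) (auto simp: l_def sum_divide_distrib exp_sum)
  have "(\<integral>\<^sup>+\<omega>. ennreal (exp ((\<Sum>j<N. f (\<omega> j)) / sqrt (real N))) \<partial>PiM {..<N} (\<lambda>_. M)) =
      (\<Prod>j<N. \<integral>\<^sup>+x. ennreal (exp (l * f x)) \<partial>M)"
    unfolding prod_eq by (rule product_nn_integral_prod) auto
  also have "\<dots> \<le> (\<Prod>j<N. ennreal (exp (l\<^sup>2 * (B - (- B))\<^sup>2 / 8)))"
    by (intro prod_mono_ennreal Hoeffdings_lemma_nn_integral_0 l mean)
  also have "\<dots> = ennreal (exp (l\<^sup>2 * (B - (- B))\<^sup>2 / 8) ^ N)"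
    by (simp add: ennreal_power)
  also have "exp (l\<^sup>2 * (B - (- B))\<^sup>2 / 8) ^ N = exp ((l\<^sup>2 * real N) * B\<^sup>2 / 2)"
    by (simp add: exp_of_nat_mult[symmetric] power2_eq_square mult_ac)
  finally show ?thesis using l by simp
qed

text \<open>
  The Marcinkiewicz-Zygmund inequality for bounded identically distributed summands. Normalised by
  \<open>sqrt N\<close>, the sum has bounded exponential moments of both signs, and these dominate every power.
  The argument works for all real exponents alike.
\<close>
lemma (in prob_space) iid_sum_moment_le:
  assumes [measurable]: "f \<in> borel_measurable M" and bound: "\<And>x. \<bar>f x\<bar> \<le> B"
    and mean: "expectation f = 0" and "N > 0" "p > 0"
  shows "(\<integral>\<^sup>+\<omega>. ennreal (\<bar>\<Sum>j<N. f (\<omega> j)\<bar> powr p) \<partial>PiM {..<N} (\<lambda>_. M))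
    \<le> ennreal (2 * exp (B\<^sup>2 / 2) * p powr p * real N powr (p / 2))"
proof -
  define S where "S = (\<lambda>\<omega>. (\<Sum>j<N. f (\<omega> j)) / sqrt (real N))"
  have [measurable]: "S \<in> borel_measurable (PiM {..<N} (\<lambda>_. M))" unfolding S_def by measurable
  define K where "K = real N powr (p / 2) * p powr p"
  have pw: "\<bar>\<Sum>j<N. f (\<omega> j)\<bar> powr p \<le> K * (exp (S \<omega>) + exp (- S \<omega>))" for \<omega>
  proof -
    have "\<bar>\<Sum>j<N. f (\<omega> j)\<bar> powr p = (sqrt (real N) * \<bar>S \<omega>\<bar>) powr p"
      using assms(4) by (simp add: S_def)
    also have "\<dots> = real N powr (p / 2) * \<bar>S \<omega>\<bar> powr p"
      by (simp add: powr_mult powr_half_sqrt[symmetric] powr_powr)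
    also have "\<dots> \<le> real N powr (p / 2) * (p powr p * exp \<bar>S \<omega>\<bar>)"
      using assms(5) by (intro mult_left_mono powr_le_exp) auto
    also have "\<dots> \<le> real N powr (p / 2) * (p powr p * (exp (S \<omega>) + exp (- S \<omega>)))"
      by (intro mult_left_mono) (auto simp: abs_if)
    finally show ?thesis by (simp add: K_def mult.assoc)
  qed
  have "(\<integral>\<^sup>+\<omega>. ennreal (\<bar>\<Sum>j<N. f (\<omega> j)\<bar> powr p) \<partial>PiM {..<N} (\<lambda>_. M))
      \<le> (\<integral>\<^sup>+\<omega>. ennreal K * (ennreal (exp (S \<omega>)) + ennreal (exp (- S \<omega>))) \<partial>PiM {..<N} (\<lambda>_. M))"
    using pw by (intro nn_integral_mono) (simp add: K_def flip: ennreal_plus ennreal_mult')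
  also have "\<dots> = ennreal K * ((\<integral>\<^sup>+\<omega>. ennreal (exp (S \<omega>)) \<partial>PiM {..<N} (\<lambda>_. M)) +
      (\<integral>\<^sup>+\<omega>. ennreal (exp (- S \<omega>)) \<partial>PiM {..<N} (\<lambda>_. M)))"
    by (simp add: nn_integral_cmult nn_integral_add)
  also have "\<dots> \<le> ennreal K * (ennreal (exp (B\<^sup>2 / 2)) + ennreal (exp (B\<^sup>2 / 2)))"
  proof (intro mult_left_mono add_mono)
    show "(\<integral>\<^sup>+\<omega>. ennreal (exp (S \<omega>)) \<partial>PiM {..<N} (\<lambda>_. M)) \<le> ennreal (exp (B\<^sup>2 / 2))"
      unfolding S_def by (rule nn_integral_exp_iid_sum_le) (use assms in auto)
    have "(\<integral>\<^sup>+\<omega>. ennreal (exp ((\<Sum>j<N. - f (\<omega> j)) / sqrt (real N))) \<partial>PiM {..<N} (\<lambda>_. M)) \<le> ennreal (exp (B\<^sup>2 / 2))"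
      by (rule nn_integral_exp_iid_sum_le) (use assms in auto)
    thus "(\<integral>\<^sup>+\<omega>. ennreal (exp (- S \<omega>)) \<partial>PiM {..<N} (\<lambda>_. M)) \<le> ennreal (exp (B\<^sup>2 / 2))"
      by (simp add: S_def sum_negf)
  qed auto
  also have "\<dots> = ennreal (2 * exp (B\<^sup>2 / 2) * p powr p * real N powr (p / 2))"
    by (simp add: K_def mult_ac flip: ennreal_plus ennreal_mult')
  finally show ?thesis .
qed

lemma powr_sum3_le:
  fixes a b c p :: real
  assumes "a \<ge> 0" "b \<ge> 0" "c \<ge> 0" "p \<ge> 0"
  shows "(a + b + c) powr p \<le> 3 powr p * (a powr p + b powr p + c powr p)"
proof -
  define m where "m = max a (max b c)"
  have "(a + b + c) powr p \<le> (3 * m) powr p"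
    using assms by (intro powr_mono2) (auto simp: m_def)
  also have "\<dots> = 3 powr p * m powr p"
    using assms by (simp add: powr_mult m_def)
  also have "m powr p \<le> a powr p + b powr p + c powr p"
    by (auto simp: m_def max_def)
  finally show ?thesis by simp
qed

text \<open>
  The sum is split into its mean \<open>N * fourier \<sigma> x\<close> and the real and imaginary parts of the deviation.
  Both parts are sums of centred variables bounded by 2, to which the previous moment bound applies.
\<close>
lemma random_exponential_sum_moment:
  fixes \<sigma> :: "(real ^ 'n) measure"
  assumes \<sigma>: "borel_prob \<sigma>" and "p > 0" "N > 0"
  shows "(\<integral>\<^sup>+\<omega>. ennreal (norm (\<Sum>j<N. expo (\<omega> j \<bullet> x)) powr p) \<partial>PiM {..<N} (\<lambda>_. \<sigma>))
    \<le> ennreal (3 powr p * (4 * exp 2 * p powr p * real N powr (p / 2) + real N powr p * norm (fourier \<sigma> x) powr p))"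
proof -
  interpret prob_space \<sigma> using \<sigma> by (simp add: borel_prob_def)
  have [measurable_cong]: "sets \<sigma> = sets borel" using \<sigma> by (simp add: borel_prob_def)
  interpret P: prob_space "PiM {..<N} (\<lambda>_. \<sigma>)" by (intro prob_space_PiM) unfold_locales
  define m where "m = fourier \<sigma> x"
  define f where "f = (\<lambda>\<xi>. Re (expo (\<xi> \<bullet> x)) - Re m)"
  define g where "g = (\<lambda>\<xi>. Im (expo (\<xi> \<bullet> x)) - Im m)"
  have [measurable]: "f \<in> borel_measurable \<sigma>" "g \<in> borel_measurable \<sigma>"
    unfolding f_def g_def by measurable
  have "norm (expo (\<xi> \<bullet> x) - m) \<le> 2" for \<xi>
    using norm_triangle_ineq4[of "expo (\<xi> \<bullet> x)" m] norm_fourier_le_1[OF \<sigma>, of x] by (simp add: m_def)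
  hence f_le: "\<bar>f \<xi>\<bar> \<le> 2" and g_le: "\<bar>g \<xi>\<bar> \<le> 2" for \<xi>
    using abs_Re_le_cmod[of "expo (\<xi> \<bullet> x) - m"] abs_Im_le_cmod[of "expo (\<xi> \<bullet> x) - m"]
    unfolding f_def g_def by (auto intro: order_trans)
  have f0: "expectation f = 0" and g0: "expectation g = 0"
    using fourier_integrable[OF \<sigma>, of x] unfolding f_def g_def m_def fourier_def
    by (simp_all add: prob_space)
  define F where "F = (\<lambda>\<omega>. \<bar>\<Sum>j<N. f (\<omega> j)\<bar> powr p)"
  define G where "G = (\<lambda>\<omega>. \<bar>\<Sum>j<N. g (\<omega> j)\<bar> powr p)"
  have [measurable]: "F \<in> borel_measurable (PiM {..<N} (\<lambda>_. \<sigma>))" "G \<in> borel_measurable (PiM {..<N} (\<lambda>_. \<sigma>))"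
    unfolding F_def G_def by measurable
  have pw: "norm (\<Sum>j<N. expo (\<omega> j \<bullet> x)) powr p \<le> 3 powr p * (F \<omega> + G \<omega> + real N powr p * norm m powr p)" for \<omega>
  proof -
    have "(\<Sum>j<N. expo (\<omega> j \<bullet> x)) =
        complex_of_real (\<Sum>j<N. f (\<omega> j)) + \<i> * complex_of_real (\<Sum>j<N. g (\<omega> j)) + of_nat N * m"
      by (simp add: complex_eq_iff f_def g_def sum_subtractf)
    hence "norm (\<Sum>j<N. expo (\<omega> j \<bullet> x)) \<le>
        \<bar>\<Sum>j<N. f (\<omega> j)\<bar> + \<bar>\<Sum>j<N. g (\<omega> j)\<bar> + real N * norm m"
      using norm_triangle_ineq[of "complex_of_real (\<Sum>j<N. f (\<omega> j)) + \<i> * complex_of_real (\<Sum>j<N. g (\<omega> j))" "of_nat N * m"]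
        norm_triangle_ineq[of "complex_of_real (\<Sum>j<N. f (\<omega> j))" "\<i> * complex_of_real (\<Sum>j<N. g (\<omega> j))"]
      unfolding norm_mult norm_ii norm_of_real norm_of_nat by simp
    hence "norm (\<Sum>j<N. expo (\<omega> j \<bullet> x)) powr p \<le>
        (\<bar>\<Sum>j<N. f (\<omega> j)\<bar> + \<bar>\<Sum>j<N. g (\<omega> j)\<bar> + real N * norm m) powr p"
      using assms(2) by (intro powr_mono2) auto
    also have "\<dots> \<le> 3 powr p * (F \<omega> + G \<omega> + (real N * norm m) powr p)"
      unfolding F_def G_def using assms(2) by (intro powr_sum3_le) auto
    finally show ?thesis by (simp add: powr_mult)
  qed
  define K where "K = 2 * exp 2 * p powr p * real N powr (p / 2)"
  have "(\<integral>\<^sup>+\<omega>. ennreal (norm (\<Sum>j<N. expo (\<omega> j \<bullet> x)) powr p) \<partial>PiM {..<N} (\<lambda>_. \<sigma>)) \<le>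
      (\<integral>\<^sup>+\<omega>. ennreal (3 powr p) * (ennreal (F \<omega>) + ennreal (G \<omega>) + ennreal (real N powr p * norm m powr p)) \<partial>PiM {..<N} (\<lambda>_. \<sigma>))"
    using pw by (intro nn_integral_mono) (simp add: F_def G_def flip: ennreal_plus ennreal_mult')
  also have "\<dots> = ennreal (3 powr p) * ((\<integral>\<^sup>+\<omega>. ennreal (F \<omega>) \<partial>PiM {..<N} (\<lambda>_. \<sigma>)) +
      (\<integral>\<^sup>+\<omega>. ennreal (G \<omega>) \<partial>PiM {..<N} (\<lambda>_. \<sigma>)) + ennreal (real N powr p * norm m powr p))"
    by (simp add: nn_integral_cmult nn_integral_add P.emeasure_space_1)
  also have "\<dots> \<le> ennreal (3 powr p) * (ennreal K + ennreal K + ennreal (real N powr p * norm m powr p))"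
  proof (intro mult_left_mono add_mono)
    show "(\<integral>\<^sup>+\<omega>. ennreal (F \<omega>) \<partial>PiM {..<N} (\<lambda>_. \<sigma>)) \<le> ennreal K"
      using iid_sum_moment_le[of f 2 N p] f_le f0 assms by (simp add: F_def K_def)
    show "(\<integral>\<^sup>+\<omega>. ennreal (G \<omega>) \<partial>PiM {..<N} (\<lambda>_. \<sigma>)) \<le> ennreal K"
      using iid_sum_moment_le[of g 2 N p] g_le g0 assms by (simp add: G_def K_def)
  qed auto
  also have "\<dots> = ennreal (3 powr p * (4 * exp 2 * p powr p * real N powr (p / 2) + real N powr p * norm (fourier \<sigma> x) powr p))"
    by (simp add: K_def m_def flip: ennreal_plus ennreal_mult')
  finally show ?thesis .
qed

section \<open>Measures with integrable Fourier transform have no atoms\<close>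

text \<open>
  A positivity argument in the spirit of Wiener's lemma. Let \<open>U\<close> be the uniform measure on a ball and
  \<open>G\<close> the transform of \<open>\<sigma>\<close> recentred at \<open>a\<close>. By Fubini the double average of \<open>G (x - y)\<close> over \<open>x\<close> and
  \<open>y\<close> is the \<open>\<sigma>\<close>-integral of the squared modulus of the transform \<open>F\<close> of \<open>U\<close>, where \<open>F a = 1\<close>, so it is
  at least the mass of \<open>a\<close>. On the other hand a bounded function in \<open>L\<^sup>p\<close> has small averages over
  large balls, since \<open>t \<le> \<epsilon> + \<epsilon> powr (1 - p) * t powr p\<close> for all \<open>t \<ge> 0\<close>. Averaging over differences
  makes the integrand nonnegative, so the contribution of \<open>a\<close> cannot be cancelled by other points.
\<close>
lemma emeasure_singleton_eq_0_if_fourier_Lp: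
  fixes \<sigma> :: "(real ^ 'n) measure"
  assumes \<sigma>: "borel_prob \<sigma>" and Lp: "fourier_Lp p \<sigma>" and "p \<ge> 1"
  shows "emeasure \<sigma> {a} = 0"
proof (rule ccontr)
  assume "emeasure \<sigma> {a} \<noteq> 0"
  interpret S: prob_space \<sigma> using \<sigma> by (simp add: borel_prob_def)
  have [measurable_cong]: "sets \<sigma> = sets borel" using \<sigma> by (simp add: borel_prob_def)
  note measurable_fourier[OF \<sigma>, measurable]
  define m where "m = measure \<sigma> {a}"
  have "m > 0"
    using \<open>emeasure \<sigma> {a} \<noteq> 0\<close> by (simp add: m_def S.emeasure_eq_measure zero_less_measure_iff)
  define \<epsilon> where "\<epsilon> = m / 2"
  have "\<epsilon> > 0" using \<open>m > 0\<close> by (simp add: \<epsilon>_def)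
  define A where "A = enn2real (\<integral>\<^sup>+x. ennreal (norm (fourier \<sigma> x) powr p) \<partial>lborel)"
  have A: "(\<integral>\<^sup>+x. ennreal (norm (fourier \<sigma> x) powr p) \<partial>lborel) = ennreal A" "A \<ge> 0"
    using Lp by (auto simp: A_def fourier_Lp_def)
  define b where "b = measure lborel (cball (0 :: real ^ 'n) 1)"
  have b: "b > 0" unfolding b_def by (rule measure_cball_pos) simp
  \<comment> \<open>large enough for the second term of the upper bound to fall below \<open>\<epsilon>\<close>, because the volume \<open>V\<close>
      of the ball is at least \<open>b * R\<close>\<close>
  define R where "R = 1 + \<epsilon> powr (1 - p) * A / (b * \<epsilon>)"
  have R: "R \<ge> 1" using b \<open>\<epsilon> > 0\<close> A(2) by (simp add: R_def)
  define V where "V = measure lborel (cball (0 :: real ^ 'n) R)"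
  have V: "V > 0" using R unfolding V_def by (intro measure_cball_pos) simp
  have "R powr 1 \<le> R powr real CARD('n)"
    using R by (intro powr_mono) (auto simp: Suc_le_eq)
  hence "b * R \<le> V"
    using R b measure_cball_scale[of R, where 'n = 'n] by (simp add: V_def b_def)
  hence V_gt: "\<epsilon> powr (1 - p) * A / V < \<epsilon>"
  proof -
    have "\<epsilon> powr (1 - p) * A < \<epsilon> * (b * R)"
      using b \<open>\<epsilon> > 0\<close> by (simp add: R_def field_simps)
    also have "\<dots> \<le> \<epsilon> * V" using \<open>b * R \<le> V\<close> \<open>\<epsilon> > 0\<close> by simp
    finally show ?thesis using V by (simp add: divide_less_eq)
  qed
  have V_em: "emeasure lborel (cball (0 :: real ^ 'n) R) = ennreal V"
    unfolding V_def by (rule emeasure_cball_eq_measure)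
  define U where "U = uniform_measure lborel (cball (0 :: real ^ 'n) R)"
  interpret U: prob_space U
    unfolding U_def by (rule prob_space_uniform_measure) (use V in \<open>auto simp: V_em\<close>)
  have [measurable_cong]: "sets U = sets borel" by (simp add: U_def)
  interpret SU: pair_prob_space \<sigma> U by unfold_locales
  define e where "e = (\<lambda>\<xi> x. expo ((\<xi> - a) \<bullet> x))"
  have e_minus: "e \<xi> (x - y) = e \<xi> x * cnj (e \<xi> y)" for \<xi> x y
    unfolding e_def by (metis diff_conv_add_uminus expo_add expo_minus inner_add_right inner_minus_right)
  have norm_e[simp]: "norm (e \<xi> x) = 1" for \<xi> x by (simp add: e_def)
  have e_meas[measurable]: "(\<lambda>z. e (fst z) (snd z)) \<in> borel_measurable (borel \<Otimes>\<^sub>M borel)"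
    unfolding e_def by measurable
  have [measurable]: "cnj \<in> borel_measurable borel"
    by (intro borel_measurable_continuous_onI continuous_intros)
  define G where "G = (\<lambda>x. LINT \<xi>|\<sigma>. e \<xi> x)"
  have norm_G: "norm (G x) = norm (fourier \<sigma> x)" for x
  proof -
    have "G x = (LINT \<xi>|\<sigma>. cnj (expo (a \<bullet> x)) * expo (\<xi> \<bullet> x))"
      unfolding G_def e_def inner_diff_left
      by (simp only: diff_conv_add_uminus expo_add expo_minus mult.commute)
    thus ?thesis by (simp add: fourier_def norm_mult)
  qed
  define F where "F = (\<lambda>\<xi>. LINT x|U. e \<xi> x)"
  have F_meas[measurable]: "F \<in> borel_measurable borel"
    unfolding F_def e_def by measurable
  have F_le: "norm (F \<xi>) \<le> 1" for \<xi>
    using integral_norm_bound[of U "e \<xi>"] by (simp add: F_def U.prob_space)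
  have "F a = 1" by (simp add: F_def e_def expo_def U.prob_space)
  have inner: "(LINT x|U. G (x - y)) = (LINT \<xi>|\<sigma>. F \<xi> * cnj (e \<xi> y))" for y
  proof -
    have "(LINT x|U. G (x - y)) = (LINT x|U. LINT \<xi>|\<sigma>. e \<xi> (x - y))" by (simp add: G_def)
    also have "\<dots> = (LINT \<xi>|\<sigma>. LINT x|U. e \<xi> (x - y))"
      by (rule SU.Fubini_integral, rule SU.P.integrable_const_bound[of _ 1])
         (auto simp: e_def split_beta)
    also have "\<dots> = (LINT \<xi>|\<sigma>. F \<xi> * cnj (e \<xi> y))"
      by (simp add: e_minus F_def)
    finally show ?thesis .
  qed
  have "(LINT y|U. LINT x|U. G (x - y)) = (LINT y|U. LINT \<xi>|\<sigma>. F \<xi> * cnj (e \<xi> y))"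
    by (simp add: inner)
  also have "\<dots> = (LINT \<xi>|\<sigma>. LINT y|U. F \<xi> * cnj (e \<xi> y))"
    by (rule SU.Fubini_integral, rule SU.P.integrable_const_bound[of _ 1])
       (auto simp: norm_mult F_le e_def split_beta)
  also have "\<dots> = (LINT \<xi>|\<sigma>. complex_of_real ((norm (F \<xi>))\<^sup>2))"
    unfolding complex_norm_square by (simp add: F_def)
  also have "\<dots> = complex_of_real (LINT \<xi>|\<sigma>. (norm (F \<xi>))\<^sup>2)"
    by (rule integral_complex_of_real)
  finally have double: "(LINT y|U. LINT x|U. G (x - y)) = complex_of_real (LINT \<xi>|\<sigma>. (norm (F \<xi>))\<^sup>2)" .
  have "m = (LINT \<xi>|\<sigma>. indicator {a} \<xi>)" by (simp add: m_def)
  also have "\<dots> \<le> (LINT \<xi>|\<sigma>. (norm (F \<xi>))\<^sup>2)"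
    using \<open>F a = 1\<close> F_le
    by (intro integral_mono S.integrable_const_bound[of _ 1])
       (auto simp: indicator_def power_le_one)
  also have "\<dots> \<le> norm (LINT y|U. LINT x|U. G (x - y))" unfolding double by simp
  finally have lower: "m \<le> norm (LINT y|U. LINT x|U. G (x - y))" .
  have pw: "norm (G x) \<le> \<epsilon> + \<epsilon> powr (1 - p) * norm (fourier \<sigma> x) powr p" for x
  proof (cases "norm (G x) \<le> \<epsilon>")
    case True
    then show ?thesis by (simp add: add_increasing2)
  next
    case False
    define t where "t = norm (G x)"
    have t: "\<epsilon> < t" using False by (simp add: t_def)
    have "t = t powr (1 - p) * t powr p"
      using t \<open>\<epsilon> > 0\<close> by (simp flip: powr_add)
    also have "\<dots> \<le> \<epsilon> powr (1 - p) * t powr p"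
      using t \<open>\<epsilon> > 0\<close> assms(3) by (intro mult_right_mono powr_mono2') auto
    finally show ?thesis using \<open>\<epsilon> > 0\<close> unfolding t_def norm_G by linarith
  qed
  define \<delta> where "\<delta> = \<epsilon> + \<epsilon> powr (1 - p) * A / V"
  have "m = \<epsilon> + \<epsilon>" by (simp add: \<epsilon>_def)
  hence \<delta>: "\<delta> < m" "\<delta> \<ge> 0" using V_gt \<open>\<epsilon> > 0\<close> V A(2) by (auto simp: \<delta>_def)
  have G_meas[measurable]: "G \<in> borel_measurable borel"
    unfolding G_def e_def by measurable
  have G_le: "norm (G x) \<le> 1" for x using norm_G norm_fourier_le_1[OF \<sigma>] by simp
  have upper_inner: "norm (LINT x|U. G (x - y)) \<le> \<delta>" for y
  proof -
    have tr: "(\<integral>\<^sup>+x. ennreal (norm (fourier \<sigma> (x - y)) powr p) \<partial>lborel) = ennreal A"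
    proof -
      have "(\<integral>\<^sup>+x. ennreal (norm (fourier \<sigma> x) powr p) \<partial>distr lborel borel ((+) (- y))) =
          (\<integral>\<^sup>+x. ennreal (norm (fourier \<sigma> (- y + x)) powr p) \<partial>lborel)"
        by (subst nn_integral_distr) auto
      thus ?thesis using A(1) by (simp add: lborel_distr_plus)
    qed
    have "ennreal (norm (LINT x|U. G (x - y))) \<le> (\<integral>\<^sup>+x. norm (G (x - y)) \<partial>U)"
      by (rule integral_norm_bound_ennreal, rule U.integrable_const_bound[of _ 1]) (auto simp: G_le)
    also have "\<dots> \<le> (\<integral>\<^sup>+x. ennreal \<epsilon> + ennreal (\<epsilon> powr (1 - p)) * ennreal (norm (fourier \<sigma> (x - y)) powr p) \<partial>U)"
      using pw \<open>\<epsilon> > 0\<close> by (intro nn_integral_mono) (simp flip: ennreal_plus ennreal_mult')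
    also have "\<dots> = ennreal \<epsilon> + ennreal (\<epsilon> powr (1 - p)) * (\<integral>\<^sup>+x. ennreal (norm (fourier \<sigma> (x - y)) powr p) \<partial>U)"
      by (simp add: nn_integral_add nn_integral_cmult U.emeasure_space_1)
    also have "(\<integral>\<^sup>+x. ennreal (norm (fourier \<sigma> (x - y)) powr p) \<partial>U) =
        (\<integral>\<^sup>+x. ennreal (norm (fourier \<sigma> (x - y)) powr p) * indicator (cball 0 R) x \<partial>lborel) / ennreal V"
      unfolding U_def by (subst nn_integral_uniform_measure) (auto simp: V_em)
    also have "\<dots> \<le> (\<integral>\<^sup>+x. ennreal (norm (fourier \<sigma> (x - y)) powr p) \<partial>lborel) / ennreal V"
      by (intro divide_right_mono_ennreal nn_integral_mono) (auto simp: indicator_def)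
    also have "\<dots> = ennreal (A / V)" unfolding tr using A(2) V by (simp add: divide_ennreal)
    finally have "ennreal (norm (LINT x|U. G (x - y))) \<le> ennreal \<epsilon> + ennreal (\<epsilon> powr (1 - p)) * ennreal (A / V)"
      by (simp add: add_left_mono mult_left_mono)
    also have "\<dots> = ennreal \<delta>"
      using A(2) V \<open>\<epsilon> > 0\<close> by (simp add: \<delta>_def flip: ennreal_plus ennreal_mult')
    finally show ?thesis using \<delta>(2) by (simp add: ennreal_le_iff)
  qed
  have "norm (LINT y|U. LINT x|U. G (x - y)) \<le> (LINT y|U. norm (LINT x|U. G (x - y)))"
    by (rule integral_norm_bound)
  also have "\<dots> \<le> (LINT y|U. \<delta>)"
    using upper_inner \<delta>(2) by (intro integral_mono U.integrable_const_bound[of _ \<delta>]) auto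
  also have "\<dots> = \<delta>" by (simp add: U.prob_space)
  finally show False using lower \<delta>(1) by simp
qed

section \<open>Random frequencies\<close>

text \<open>By the Lindelof property the complement of the support is a countable union of open null sets.\<close>
lemma AE_in_msupp:
  fixes \<sigma> :: "'a :: second_countable_topology measure"
  assumes "sets \<sigma> = sets borel"
  shows "AE \<xi> in \<sigma>. \<xi> \<in> msupp \<sigma>"
proof -
  define \<U> where "\<U> = {U. open U \<and> emeasure \<sigma> U = 0}"
  obtain \<V> where \<V>: "\<V> \<subseteq> \<U>" "countable \<V>" "\<Union>\<V> = \<Union>\<U>"
    using Lindelof[of \<U>] by (auto simp: \<U>_def)
  have "\<Union>\<V> \<in> null_sets \<sigma>"
    using \<V>(1,2) assms
    by (intro null_sets_UN'[of \<V> "\<lambda>x. x", simplified]) (auto simp: \<U>_def null_sets_def)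
  moreover have "{\<xi>. \<xi> \<notin> msupp \<sigma>} \<subseteq> \<Union>\<U>"
    by (auto simp: msupp_def \<U>_def)
  ultimately show ?thesis
    using \<V>(3) by (intro AE_I'[of "\<Union>\<V>"]) auto
qed

text \<open>Given all points but the \<open>i\<close>-th, the \<open>i\<close>-th one hits the \<open>j\<close>-th with probability zero.\<close>
lemma AE_iid_inj:
  fixes M :: "'a :: {second_countable_topology, t2_space} measure"
  assumes "prob_space M" and sets_M: "sets M = sets borel" and atomless: "\<And>a. emeasure M {a} = 0"
  shows "AE \<omega> in PiM {..<N::nat} (\<lambda>_. M). inj_on \<omega> {..<N}"
proof -
  interpret prob_space M by fact
  interpret product_sigma_finite "\<lambda>_::nat. M" by unfold_locales
  note sets_M[measurable_cong]
  have comp: "(\<lambda>\<omega>. \<omega> k) \<in> borel_measurable (PiM {..<N} (\<lambda>_. M))" if "k < N" for k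
    using measurable_component_singleton[of k "{..<N}" "\<lambda>_. M"] that
    by (simp cong: measurable_cong_sets add: sets_M)
  have ne: "AE \<omega> in PiM {..<N} (\<lambda>_. M). \<omega> i \<noteq> \<omega> j" if ij: "i < N" "j < N" "i \<noteq> j" for i j
  proof -
    have I: "insert i ({..<N} - {i}) = {..<N}" using ij by auto
    let ?D = "{z::'a\<times>'a. fst z = snd z}"
    have D_sets: "?D \<in> sets (borel \<Otimes>\<^sub>M borel)"
    proof -
      have "closed ?D" by (intro closed_Collect_eq continuous_intros)
      thus ?thesis unfolding borel_prod by (rule borel_closed)
    qed
    have D_meas: "(\<lambda>\<omega>. indicator ?D (\<omega> i, \<omega> j) :: ennreal) \<in> borel_measurable (PiM {..<N} (\<lambda>_. M))"
      by (rule measurable_compose[OF measurable_Pair borel_measurable_indicator[OF D_sets]])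
         (use comp ij in auto)
    have "(\<integral>\<^sup>+\<omega>. indicator ?D (\<omega> i, \<omega> j) \<partial>PiM {..<N} (\<lambda>_. M)) =
        (\<integral>\<^sup>+\<omega>. (\<integral>\<^sup>+y. indicator ?D (fun_upd \<omega> i y i, fun_upd \<omega> i y j) \<partial>M) \<partial>PiM ({..<N} - {i}) (\<lambda>_. M))"
      by (rule product_nn_integral_insert[of "{..<N} - {i}" i "\<lambda>\<omega>. indicator ?D (\<omega> i, \<omega> j)", unfolded I, OF _ _ D_meas])
         auto
    also have "\<dots> = (\<integral>\<^sup>+\<omega>. (\<integral>\<^sup>+y. indicator {\<omega> j} y \<partial>M) \<partial>PiM ({..<N} - {i}) (\<lambda>_. M))"
      using ij by (intro nn_integral_cong) (auto simp: indicator_def)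
    also have "\<dots> = 0" using atomless sets_M by simp
    finally have "AE \<omega> in PiM {..<N} (\<lambda>_. M). (indicator ?D (\<omega> i, \<omega> j) :: ennreal) = 0"
      using D_meas by (simp add: nn_integral_0_iff_AE)
    thus ?thesis by eventually_elim (auto simp: indicator_def split: if_splits)
  qed
  have "AE \<omega> in PiM {..<N} (\<lambda>_. M). \<forall>i\<in>{..<N}. \<forall>j\<in>{..<N}. i \<noteq> j \<longrightarrow> \<omega> i \<noteq> \<omega> j"
    by (intro AE_finite_allI finite_lessThan) (use ne in auto)
  thus ?thesis by eventually_elim (auto simp: inj_on_def)
qed

text \<open>
  If \<open>g\<close> exceeded \<open>2 * c\<close> wherever \<open>Q\<close> holds, its integral would be at least \<open>2 * c\<close>. The factor 2
  makes this a strict contradiction and costs only a constant in the application.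
\<close>
lemma (in prob_space) exists_below_twice_mean:
  assumes [measurable]: "g \<in> borel_measurable M"
    and "(\<integral>\<^sup>+\<omega>. g \<omega> \<partial>M) \<le> ennreal c" "c > 0" and "AE \<omega> in M. Q \<omega>"
  obtains \<omega> where "Q \<omega>" "g \<omega> \<le> ennreal (2 * c)"
proof (rule ccontr)
  assume "\<not> thesis"
  with that have "Q \<omega> \<Longrightarrow> ennreal (2 * c) \<le> g \<omega>" for \<omega> by (meson linear)
  with assms(4) have "AE \<omega> in M. ennreal (2 * c) \<le> g \<omega>" by (auto elim: eventually_mono)
  hence "(\<integral>\<^sup>+\<omega>. ennreal (2 * c) \<partial>M) \<le> (\<integral>\<^sup>+\<omega>. g \<omega> \<partial>M)" by (rule nn_integral_mono_AE)
  also note assms(2)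
  finally show False using assms(3) by (simp add: emeasure_space_1 ennreal_le_iff)
qed

text \<open>
  The first moment method applied to a random sample of \<open>N\<close> points, where \<open>N\<close> is \<open>R powr (2 * d / p)\<close>
  rounded up. Rounding costs at most a factor 2 because \<open>R \<ge> 1\<close>.
\<close>
lemma good_frequencies_from_measure:
  fixes \<sigma> :: "(real ^ 'n) measure"
  assumes "p \<ge> 1" and \<sigma>: "borel_prob \<sigma>" and supp: "msupp \<sigma> \<subseteq> E" and Lp: "fourier_Lp p \<sigma>"
  obtains C where "C > 0" "\<And>R. R \<ge> 1 \<Longrightarrow> \<exists>P. good_frequencies p E 1 C R P"
proof -
  interpret S: prob_space \<sigma> using \<sigma> by (simp add: borel_prob_def)
  have sets_\<sigma>[measurable_cong]: "sets \<sigma> = sets borel" using \<sigma> by (simp add: borel_prob_def)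
  note measurable_fourier[OF \<sigma>, measurable]
  define d where "d = real CARD('n)"
  define A where "A = enn2real (\<integral>\<^sup>+x. ennreal (norm (fourier \<sigma> x) powr p) \<partial>lborel)"
  have A: "(\<integral>\<^sup>+x. ennreal (norm (fourier \<sigma> x) powr p) \<partial>lborel) = ennreal A" "A \<ge> 0"
    using Lp by (auto simp: A_def fourier_Lp_def)
  define b where "b = measure lborel (cball (0 :: real ^ 'n) 1)"
  have b: "b > 0" unfolding b_def by (rule measure_cball_pos) simp
  define K where "K = 4 * exp 2 * p powr p"
  have K: "K > 0" using assms(1) by (simp add: K_def)
  define C\<^sub>0 where "C\<^sub>0 = 3 powr p * (K + 2 powr (p / 2) * A / b)"
  have C0: "C\<^sub>0 > 0" using K A(2) b by (simp add: C\<^sub>0_def add_pos_nonneg)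
  show ?thesis
  proof (rule that[of "2 + 2 * C\<^sub>0"])
    show "2 + 2 * C\<^sub>0 > 0" using C0 by simp
    fix R :: real assume R: "R \<ge> 1"
    define L where "L = R powr (2 * d / p)"
    have L: "L \<ge> 1" using R assms(1) unfolding L_def by (intro ge_one_powr_ge_zero) (auto simp: d_def)
    define N where "N = nat \<lceil>L\<rceil>"
    have N: "L \<le> real N" "real N \<le> 2 * L" "N > 0" using L unfolding N_def by linarith+
    define V where "V = measure lborel (cball (0 :: real ^ 'n) R)"
    have V: "V = b * R powr d" "V > 0"
      using R measure_cball_scale[of R, where 'n = 'n] measure_cball_pos[of R, where 'n = 'n] by (simp_all add: V_def b_def d_def)
    have V_em: "emeasure lborel (cball (0 :: real ^ 'n) R) = ennreal V"
      unfolding V_def by (rule emeasure_cball_eq_measure)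
    have cball_meas[measurable]: "cball (0 :: real ^ 'n) R \<in> sets borel" by simp
    define M where "M = PiM {..<N} (\<lambda>_. \<sigma>)"
    interpret M: prob_space M unfolding M_def by (intro prob_space_PiM) unfold_locales
    interpret MB: pair_sigma_finite M "lborel :: (real ^ 'n) measure" by unfold_locales
    define h where "h = (\<lambda>\<omega> x. indicator (cball (0 :: real ^ 'n) R) x * ennreal (norm (\<Sum>j<N. expo (\<omega> j \<bullet> x)) powr p))"
    have h_meas: "case_prod h \<in> borel_measurable (M \<Otimes>\<^sub>M lborel)"
      unfolding h_def M_def by measurable
    have "(\<integral>\<^sup>+\<omega>. \<integral>\<^sup>+x. h \<omega> x \<partial>lborel \<partial>M) = (\<integral>\<^sup>+x. \<integral>\<^sup>+\<omega>. h \<omega> x \<partial>M \<partial>lborel)"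
      using MB.Fubini'[OF h_meas] by simp
    also have "\<dots> \<le> (\<integral>\<^sup>+x. ennreal (3 powr p) * (ennreal (K * real N powr (p / 2)) * indicator (cball 0 R) x +
        ennreal (real N powr p) * ennreal (norm (fourier \<sigma> x) powr p)) \<partial>lborel)"
    proof (rule nn_integral_mono)
      fix x :: "real ^ 'n"
      have "(\<integral>\<^sup>+\<omega>. h \<omega> x \<partial>M) = indicator (cball 0 R) x * (\<integral>\<^sup>+\<omega>. ennreal (norm (\<Sum>j<N. expo (\<omega> j \<bullet> x)) powr p) \<partial>M)"
        unfolding h_def by (rule nn_integral_cmult) (unfold M_def, measurable)
      also have "\<dots> \<le> indicator (cball 0 R) x * ennreal (3 powr p * (K * real N powr (p / 2) + real N powr p * norm (fourier \<sigma> x) powr p))"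
        unfolding M_def K_def using assms(1) N(3)
        by (intro mult_left_mono random_exponential_sum_moment[OF \<sigma>]) auto
      also have "\<dots> \<le> ennreal (3 powr p) * (ennreal (K * real N powr (p / 2)) * indicator (cball 0 R) x +
          ennreal (real N powr p) * ennreal (norm (fourier \<sigma> x) powr p))"
        using K by (cases "x \<in> cball 0 R") (simp_all flip: ennreal_plus ennreal_mult')
      finally show "(\<integral>\<^sup>+\<omega>. h \<omega> x \<partial>M) \<le> ennreal (3 powr p) * (ennreal (K * real N powr (p / 2)) * indicator (cball 0 R) x +
          ennreal (real N powr p) * ennreal (norm (fourier \<sigma> x) powr p))" .
    qed
    also have "\<dots> = ennreal (3 powr p) * (ennreal (K * real N powr (p / 2)) * ennreal V + ennreal (real N powr p) * ennreal A)"
      by (simp add: nn_integral_cmult nn_integral_add nn_integral_cmult_indicator V_em A(1))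
    also have "\<dots> = ennreal (3 powr p * (K * real N powr (p / 2) * V + real N powr p * A))"
      using K V(2) A(2) by (simp flip: ennreal_plus ennreal_mult')
    also have "\<dots> \<le> ennreal (C\<^sub>0 * real N powr (p / 2) * V)"
    proof (rule ennreal_leI)
      \<comment> \<open>one of the two factors \<open>N powr (p / 2)\<close> of \<open>N powr p\<close> is traded for the volume of the ball\<close>
      have "real N powr (p / 2) \<le> (2 * L) powr (p / 2)"
        using N assms(1) by (intro powr_mono2) auto
      also have "\<dots> = 2 powr (p / 2) * R powr d"
        using L R assms(1) by (simp add: powr_mult L_def powr_powr)
      also have "\<dots> = 2 powr (p / 2) / b * V" using b by (simp add: V(1))
      finally have "real N powr p \<le> real N powr (p / 2) * (2 powr (p / 2) / b * V)"
        using mult_left_mono[of "real N powr (p / 2)" "2 powr (p / 2) / b * V" "real N powr (p / 2)"]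
        by (simp flip: powr_add)
      hence "real N powr p * A \<le> real N powr (p / 2) * (2 powr (p / 2) / b * V) * A"
        using A(2) by (rule mult_right_mono)
      hence "3 powr p * (K * real N powr (p / 2) * V + real N powr p * A) \<le>
          3 powr p * (K * real N powr (p / 2) * V + real N powr (p / 2) * (2 powr (p / 2) / b * V) * A)"
        by (intro mult_left_mono add_left_mono) auto
      also have "\<dots> = C\<^sub>0 * real N powr (p / 2) * V"
        by (simp add: C\<^sub>0_def algebra_simps)
      finally show "3 powr p * (K * real N powr (p / 2) * V + real N powr p * A) \<le> C\<^sub>0 * real N powr (p / 2) * V" .
    qed
    finally have mean_h: "(\<integral>\<^sup>+\<omega>. \<integral>\<^sup>+x. h \<omega> x \<partial>lborel \<partial>M) \<le> ennreal (C\<^sub>0 * real N powr (p / 2) * V)" .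
    have "AE \<omega> in M. inj_on \<omega> {..<N}"
      unfolding M_def
      using AE_iid_inj[OF S.prob_space_axioms sets_\<sigma> emeasure_singleton_eq_0_if_fourier_Lp[OF \<sigma> Lp assms(1)]] .
    moreover have "AE \<omega> in M. \<forall>j\<in>{..<N}. \<omega> j \<in> msupp \<sigma>"
      unfolding M_def
      by (intro AE_finite_allI finite_lessThan AE_PiM_component S.prob_space_axioms AE_in_msupp[OF sets_\<sigma>])
    ultimately have AE_good: "AE \<omega> in M. inj_on \<omega> {..<N} \<and> (\<forall>j\<in>{..<N}. \<omega> j \<in> msupp \<sigma>)"
      by eventually_elim simp
    have int_h_meas: "(\<lambda>\<omega>. \<integral>\<^sup>+x. h \<omega> x \<partial>lborel) \<in> borel_measurable M"
      using lborel.borel_measurable_nn_integral[OF h_meas] .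
    have "C\<^sub>0 * real N powr (p / 2) * V > 0" using C0 N(3) V(2) by simp
    from M.exists_below_twice_mean[OF int_h_meas mean_h this AE_good]
    obtain \<omega> where inj: "inj_on \<omega> {..<N}" and in_supp: "\<forall>j\<in>{..<N}. \<omega> j \<in> msupp \<sigma>"
      and h_le: "(\<integral>\<^sup>+x. h \<omega> x \<partial>lborel) \<le> ennreal (2 * (C\<^sub>0 * real N powr (p / 2) * V))"
      by blast
    define P where "P = \<omega> ` {..<N}"
    have card_P: "card P = N" unfolding P_def using inj by (simp add: card_image)
    have "h \<omega> x = indicator (cball 0 R) x * ennreal (norm (\<Sum>\<xi>\<in>P. expo (\<xi> \<bullet> x)) powr p)" for x
      unfolding h_def P_def using inj by (simp add: sum.reindex o_def)
    hence "ennreal (V * ball_average p R P) = (\<integral>\<^sup>+x. h \<omega> x \<partial>lborel)"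
      using R assms(1) by (simp add: nn_integral_cball_exponential_sum V_def P_def)
    also note h_le
    finally have "V * ball_average p R P \<le> 2 * (C\<^sub>0 * real N powr (p / 2) * V)"
      using C0 V(2) by (subst (asm) ennreal_le_iff) auto
    hence "V * ball_average p R P \<le> V * (2 * C\<^sub>0 * real N powr (p / 2))" by (simp add: mult_ac)
    hence "ball_average p R P \<le> 2 * C\<^sub>0 * real N powr (p / 2)"
      using V(2) by simp
    also have "\<dots> \<le> (2 + 2 * C\<^sub>0) * real N powr (p / 2)" by (intro mult_right_mono) auto
    finally have avg: "ball_average p R P \<le> (2 + 2 * C\<^sub>0) * real (card P) powr (p / 2)" by (simp add: card_P)
    have "2 * L \<le> (2 + 2 * C\<^sub>0) * L" using C0 L by (intro mult_right_mono) auto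
    hence "real N \<le> (2 + 2 * C\<^sub>0) * L" using N(2) by linarith
    hence "good_frequencies p E 1 (2 + 2 * C\<^sub>0) R P"
      unfolding good_frequencies_def using N(1) avg in_supp supp card_P
      by (auto simp: P_def L_def d_def)
    thus "\<exists>P. good_frequencies p E 1 (2 + 2 * C\<^sub>0) R P" ..
  qed
qed

section \<open>The equivalence\<close>

theorem theorem4p2:
  fixes E :: "(real ^ 'n) set" and p :: real
  assumes "p \<ge> 2" and "compact E"
  shows
    "(\<forall>\<sigma> :: (real ^ 'n) measure.
        borel_prob \<sigma> \<and> msupp \<sigma> \<subseteq> E \<and> fourier_Lp p \<sigma> \<and> has_equal_partitions \<sigma> \<longrightarrow>
        (\<exists>R\<^sub>0 c C. R\<^sub>0 > 0 \<and> c > 0 \<and> C > 0 \<and>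
          (\<forall>R\<ge>R\<^sub>0. \<exists>P. good_frequencies p E c C R P)))
     \<and>
     (\<forall>(c :: real) (C :: real) (r :: nat \<Rightarrow> real).
        c > 0 \<and> C > 0 \<and> (\<forall>k. r k > 0) \<and> filterlim r at_top sequentially \<and>
        (\<forall>k. \<exists>P. good_frequencies p E c C (r k) P) \<longrightarrow>
        (\<exists>\<sigma> :: (real ^ 'n) measure.
          borel_prob \<sigma> \<and> msupp \<sigma> \<subseteq> E \<and> fourier_Lp p \<sigma>))"
proof (intro conjI allI impI)
  fix \<sigma> :: "(real ^ 'n) measure"
  assume "borel_prob \<sigma> \<and> msupp \<sigma> \<subseteq> E \<and> fourier_Lp p \<sigma> \<and> has_equal_partitions \<sigma>"
  then obtain C where "C > 0" "\<And>R. R \<ge> 1 \<Longrightarrow> \<exists>P. good_frequencies p E 1 C R P"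
    using good_frequencies_from_measure[of p \<sigma> E] assms(1) by auto
  thus "\<exists>R\<^sub>0 c C. R\<^sub>0 > 0 \<and> c > 0 \<and> C > 0 \<and> (\<forall>R\<ge>R\<^sub>0. \<exists>P. good_frequencies p E c C R P)"
    by (intro exI[of _ 1] exI[of _ C]) auto
next
  fix c C :: real and r :: "nat \<Rightarrow> real"
  assume *: "c > 0 \<and> C > 0 \<and> (\<forall>k. r k > 0) \<and> filterlim r at_top sequentially \<and>
        (\<forall>k. \<exists>P. good_frequencies p E c C (r k) P)"
  then obtain P where "\<And>k. good_frequencies p E c C (r k) (P k)" by metis
  with * assms obtain \<sigma> :: "(real ^ 'n) measure" where "borel_prob \<sigma>" "msupp \<sigma> \<subseteq> E" "fourier_Lp p \<sigma>"
    using measure_from_good_frequencies[of p E c C r P] by auto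
  thus "\<exists>\<sigma> :: (real ^ 'n) measure. borel_prob \<sigma> \<and> msupp \<sigma> \<subseteq> E \<and> fourier_Lp p \<sigma>" by blast
qed

end
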